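(* Let $x^\ast$ be a feasible point of the MPVC at which MPVC-CPLD holds. Then $x^\ast$ satisfies MPVC-generalized quasinormality.
   Context: The mathematical program with vanishing constraints (MPVC) is: minimize $f(x)$ over $x\in\mathbb{R}^n$ subject to $g_i(x)\le 0$ ($i=1,\dots,m$), $h_i(x)=0$ ($i=1,\dots,p$), $H_i(x)\ge 0$ and $G_i(x)H_i(x)\le 0$ ($i=1,\dots,q$), where all functions $f,g_i,h_i,G_i,H_i:\mathbb{R}^n\to\mathbb{R}$ are continuously differentiable. Let $\mathcal{C}$ be its feasible set. For $x^\ast\in\mathcal{C}$ put $I_g=\{i: g_i(x^\ast)=0\}$, $I_+=\{i:H_i(x^\ast)>0\}$, $I_{+0}=\{i:H_i(x^\ast)>0,G_i(x^\ast)=0\}$, $I_{+-}=\{i:H_i(x^\ast)>0,G_i(x^\ast)<0\}$, $I_{00}=\{i:H_i(x^\ast)=0,G_i(x^\ast)=0\}$, $I_{0+}=\{i:H_i(x^\ast)=0,G_i(x^\ast)>0\}$, $I_{0-}=\{i:H_i(x^\ast)=0,G_i(x^\ast)<0\}$. MPVC-CPLD holds at $x^\ast\in\mathcal{C}$ if for any index sets $I_h\subset\{1,\dots,p\}$, $J_0\subset I_g$, $L_0^H\subset I_{0+}\cup I_{00}\cup I_{0-}$, $L_0^G\subset I_{+0}\cup I_{00}$: whenever there exist $\lambda_j\ge0$ ($j\in J_0$), $\mu_i$ ($i\in I_h$), $\eta_l^H$ ($l\in L_0^H$), $\eta_l^G$ ($l\in L_0^G$), not all zero, such that $$\sum_{j\in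 J_0}\lambda_j\nabla g_j(x^\ast)+\sum_{i\in I_h}\mu_i\nabla h_i(x^\ast)+\sum_{l\in L_0^G}\eta_l^G\nabla G_l(x^\ast)-\sum_{l\in L_0^H}\eta_l^H\nabla H_l(x^\ast)=0$$ and $\eta_l^G\eta_l^H=0$ for all $l\in I_{00}$ (with $\eta_l^G:=0$ for $l\notin L_0^G$ and $\eta_l^H:=0$ for $l\notin L_0^H$), then there is a neighbourhood $U(x^\ast)$ of $x^\ast$ such that for every $x\in U(x^\ast)$ the family of vectors $\{\nabla h_i(x)\}_{i\in I_h}$, $\{\nabla g_j(x)\}_{j\in J_0}$, $\{\nabla G_l(x)\}_{l\in L_0^G}$, $\{\nabla H_l(x)\}_{l\in L_0^H}$ is linearly dependent. $x^\ast\in\mathcal{C}$ satisfies MPVC-generalized quasinormality if there is no nonzero $(\lambda,\mu,\eta^G,\eta^H)\in\mathbb{R}^m\times\mathbb{R}^p\times\mathbb{R}^q\times\mathbb{R}^q$ such that: (i) $\sum_{i=1}^m\lambda_i\nabla g_i(x^\ast)+\sum_{i=1}^p\mu_i\nabla h_i(x^\ast)+\sum_{i=1}^q\eta_i^G\nabla G_i(x^\ast)-\sum_{i=1}^q\eta_i^H\nabla H_i(x^\ast)=0$; (ii) $\lambda_i\ge0$ for $i\in I_g$, $\lambda_i=0$ for $i\notin I_g$; $\eta_i^G=0$ for $i\in I_{+-}\cup I_{0-}\cup I_{0+}$, $\eta_i^G\ge0$ for $i\in I_{+0}\cup I_{00}$; $\eta_i^H=0$ for $i\in I_+$, $\eta_i^H\ge0$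 for $i\in I_{0-}$, $\eta_i^H$ free for $i\in I_{0+}$; $\eta_i^H\eta_i^G=0$ for $i\in I_{00}$; (iii) there is a sequence $x^k\to x^\ast$ in $\mathbb{R}^n$ such that for all $k\in\mathbb{N}$: $\lambda_i>0\Rightarrow\lambda_ig_i(x^k)>0$ ($i=1,\dots,m$); $\mu_i\ne0\Rightarrow\mu_ih_i(x^k)>0$ ($i=1,\dots,p$); $\eta_i^H\ne0\Rightarrow\eta_i^HH_i(x^k)<0$ ($i=1,\dots,q$); $\eta_i^G>0\Rightarrow\eta_i^GG_i(x^k)>0$ ($i=1,\dots,q$). *)

theory Defs
  imports "HOL-Analysis.Analysis"
begin

definition grad :: "(real^'n \<Rightarrow> real) \<Rightarrow> real^'n \<Rightarrow> real^'n" where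
  "grad F x = (THE D. GDERIV F x :> D)"

lemma GDERIV_grad:
  fixes F :: "real^'n \<Rightarrow> real"
  assumes "F differentiable (at x)"
  shows "GDERIV F x :> grad F x"
proof -
  obtain F' where F': "(F has_derivative F') (at x)"
    using assms by (auto simp: differentiable_def)
  then have lin: "linear F'" by (rule has_derivative_linear)
  have "F' = (\<lambda>h. h \<bullet> adjoint F' 1)"
  proof
    fix h
    show "F' h = h \<bullet> adjoint F' 1"
      using adjoint_works[OF lin, of h 1] by simp
  qed
  then have D: "GDERIV F x :> adjoint F' 1"
    using F' by (simp add: gderiv_def)
  have uniq: "D = E" if "GDERIV F x :> D" "GDERIV F x :> E" for D E
  proof -
    have "(\<lambda>h. h \<bullet> D) = (\<lambda>h. h \<bullet> E)"
      using that unfolding gderiv_def by (rule has_derivative_unique)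
    then have "\<forall>h. h \<bullet> D = h \<bullet> E" by (simp add: fun_eq_iff)
    then show ?thesis by (rule vector_eq_ldot[THEN iffD1])
  qed
  show ?thesis
    unfolding grad_def by (rule theI[where P = "\<lambda>D. GDERIV F x :> D", OF D uniq[OF _ D]])
qed

definition continuously_differentiable :: "(real^'n \<Rightarrow> real) \<Rightarrow> bool" where
  "continuously_differentiable F \<longleftrightarrow>
     (\<forall>x. F differentiable (at x)) \<and> continuous_on UNIV (grad F)"

text \<open>
  The data of a mathematical program with vanishing constraints:
  minimize \<open>f x\<close> subject to
  \<open>g\<^sub>i x \<le> 0\<close> for \<open>i = 1, \<dots>, m\<close>,
  \<open>h\<^sub>i x = 0\<close> for \<open>i = 1, \<dots>, p\<close>, and
  \<open>H\<^sub>i x \<ge> 0\<close>, \<open>G\<^sub>i x * H\<^sub>i x \<le> 0\<close> for \<open>i = 1, \<dots>, q\<close>.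
  Any of \<open>m\<close>, \<open>p\<close>, \<open>q\<close> may be zero; constraint functions and multipliers are functions on
  \<open>nat\<close> of which only the values at indices in range matter.
  The record fields are these letters doubled.
\<close>

record ('n::finite) mpvc =
  mm :: nat
  pp :: nat
  qq :: nat
  ff :: "real^'n \<Rightarrow> real"
  gg :: "nat \<Rightarrow> real^'n \<Rightarrow> real"
  hh :: "nat \<Rightarrow> real^'n \<Rightarrow> real"
  GG :: "nat \<Rightarrow> real^'n \<Rightarrow> real"
  HH :: "nat \<Rightarrow> real^'n \<Rightarrow> real"

definition mpvc_C1 :: "'n::finite mpvc \<Rightarrow> bool" where
  "mpvc_C1 P \<longleftrightarrow>
     continuously_differentiable (ff P) \<and>
     (\<forall>i\<in>{1..mm P}. continuously_differentiable (gg P i)) \<and>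
     (\<forall>i\<in>{1..pp P}. continuously_differentiable (hh P i)) \<and>
     (\<forall>i\<in>{1..qq P}. continuously_differentiable (GG P i)) \<and>
     (\<forall>i\<in>{1..qq P}. continuously_differentiable (HH P i))"

definition feasible_set :: "'n::finite mpvc \<Rightarrow> (real^'n) set" where
  "feasible_set P = {x.
     (\<forall>i\<in>{1..mm P}. gg P i x \<le> 0) \<and>
     (\<forall>i\<in>{1..pp P}. hh P i x = 0) \<and>
     (\<forall>i\<in>{1..qq P}. HH P i x \<ge> 0 \<and> GG P i x * HH P i x \<le> 0)}"

definition I_g :: "'n::finite mpvc \<Rightarrow> real^'n \<Rightarrow> nat set" where
  "I_g P x = {i\<in>{1..mm P}. gg P i x = 0}"

text \<open>In the names below, \<open>p\<close>, \<open>m\<close>, \<open>0\<close> stand for positive, negative and zero;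
  the first letter gives the sign of \<open>H\<^sub>i x\<close>, the second that of \<open>G\<^sub>i x\<close>.\<close>

definition I_p :: "'n::finite mpvc \<Rightarrow> real^'n \<Rightarrow> nat set" where
  "I_p P x = {i\<in>{1..qq P}. HH P i x > 0}"

definition I_p0 :: "'n::finite mpvc \<Rightarrow> real^'n \<Rightarrow> nat set" where
  "I_p0 P x = {i\<in>{1..qq P}. HH P i x > 0 \<and> GG P i x = 0}"

definition I_pm :: "'n::finite mpvc \<Rightarrow> real^'n \<Rightarrow> nat set" where
  "I_pm P x = {i\<in>{1..qq P}. HH P i x > 0 \<and> GG P i x < 0}"

definition I_00 :: "'n::finite mpvc \<Rightarrow> real^'n \<Rightarrow> nat set" where
  "I_00 P x = {i\<in>{1..qq P}. HH P i x = 0 \<and> GG P i x = 0}"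

definition I_0p :: "'n::finite mpvc \<Rightarrow> real^'n \<Rightarrow> nat set" where
  "I_0p P x = {i\<in>{1..qq P}. HH P i x = 0 \<and> GG P i x > 0}"

definition I_0m :: "'n::finite mpvc \<Rightarrow> real^'n \<Rightarrow> nat set" where
  "I_0m P x = {i\<in>{1..qq P}. HH P i x = 0 \<and> GG P i x < 0}"

text \<open>Linear dependence of the gradients as an indexed family, as opposed to
  \<^const>\<open>dependent\<close> of the set of its members: two indices carrying the same vector already make
  the family dependent.\<close>

definition gradients_dependent ::
  "'n::finite mpvc \<Rightarrow> nat set \<Rightarrow> nat set \<Rightarrow> nat set \<Rightarrow> nat set \<Rightarrow> real^'n \<Rightarrow> bool" where
  "gradients_dependent P Ih J0 L0H L0G x \<longleftrightarrow>
     (\<exists>a b c d :: nat \<Rightarrow> real.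
        ((\<exists>i\<in>Ih. a i \<noteq> 0) \<or> (\<exists>j\<in>J0. b j \<noteq> 0) \<or> (\<exists>l\<in>L0G. c l \<noteq> 0) \<or> (\<exists>l\<in>L0H. d l \<noteq> 0)) \<and>
        (\<Sum>i\<in>Ih. a i *\<^sub>R grad (hh P i) x) + (\<Sum>j\<in>J0. b j *\<^sub>R grad (gg P j) x)
          + (\<Sum>l\<in>L0G. c l *\<^sub>R grad (GG P l) x) + (\<Sum>l\<in>L0H. d l *\<^sub>R grad (HH P l) x) = 0)"

definition MPVC_CPLD :: "'n::finite mpvc \<Rightarrow> real^'n \<Rightarrow> bool" where
  "MPVC_CPLD P xs \<longleftrightarrow>
     (\<forall>Ih J0 L0H L0G.
        Ih \<subseteq> {1..pp P} \<longrightarrow> J0 \<subseteq> I_g P xs \<longrightarrow>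
        L0H \<subseteq> I_0p P xs \<union> I_00 P xs \<union> I_0m P xs \<longrightarrow> L0G \<subseteq> I_p0 P xs \<union> I_00 P xs \<longrightarrow>
        (\<exists>lam mu etaH etaG :: nat \<Rightarrow> real.
           (\<forall>j\<in>J0. lam j \<ge> 0) \<and>
           (\<forall>l. l \<notin> L0G \<longrightarrow> etaG l = 0) \<and>
           (\<forall>l. l \<notin> L0H \<longrightarrow> etaH l = 0) \<and>
           ((\<exists>j\<in>J0. lam j \<noteq> 0) \<or> (\<exists>i\<in>Ih. mu i \<noteq> 0) \<or>
            (\<exists>l\<in>L0H. etaH l \<noteq> 0) \<or> (\<exists>l\<in>L0G. etaG l \<noteq> 0)) \<and>
           (\<Sum>j\<in>J0. lam j *\<^sub>R grad (gg P j) xs) + (\<Sum>i\<in>Ih. mu i *\<^sub>R grad (hh P i) xs)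
             + (\<Sum>l\<in>L0G. etaG l *\<^sub>R grad (GG P l) xs)
             - (\<Sum>l\<in>L0H. etaH l *\<^sub>R grad (HH P l) xs) = 0 \<and>
           (\<forall>l\<in>I_00 P xs. etaG l * etaH l = 0)) \<longrightarrow>
        (\<exists>U. open U \<and> xs \<in> U \<and> (\<forall>x\<in>U. gradients_dependent P Ih J0 L0H L0G x)))"

definition MPVC_generalized_quasinormality :: "'n::finite mpvc \<Rightarrow> real^'n \<Rightarrow> bool" where
  "MPVC_generalized_quasinormality P xs \<longleftrightarrow>
     \<not> (\<exists>lam mu etaG etaH :: nat \<Rightarrow> real.
        ((\<exists>i\<in>{1..mm P}. lam i \<noteq> 0) \<or> (\<exists>i\<in>{1..pp P}. mu i \<noteq> 0) \<or>
         (\<exists>i\<in>{1..qq P}. etaG i \<noteq> 0) \<or> (\<exists>i\<in>{1..qq P}. etaH i \<noteq> 0)) \<and>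
        (\<Sum>i=1..mm P. lam i *\<^sub>R grad (gg P i) xs) + (\<Sum>i=1..pp P. mu i *\<^sub>R grad (hh P i) xs)
          + (\<Sum>i=1..qq P. etaG i *\<^sub>R grad (GG P i) xs)
          - (\<Sum>i=1..qq P. etaH i *\<^sub>R grad (HH P i) xs) = 0 \<and>
        (\<forall>i\<in>I_g P xs. lam i \<ge> 0) \<and>
        (\<forall>i\<in>{1..mm P} - I_g P xs. lam i = 0) \<and>
        (\<forall>i\<in>I_pm P xs \<union> I_0m P xs \<union> I_0p P xs. etaG i = 0) \<and>
        (\<forall>i\<in>I_p0 P xs \<union> I_00 P xs. etaG i \<ge> 0) \<and>
        (\<forall>i\<in>I_p P xs. etaH i = 0) \<and>
        (\<forall>i\<in>I_0m P xs. etaH i \<ge> 0) \<and>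
        (\<forall>i\<in>I_00 P xs. etaH i * etaG i = 0) \<and>
        (\<exists>X :: nat \<Rightarrow> real^'n. X \<longlonglongrightarrow> xs \<and>
           (\<forall>k.
              (\<forall>i\<in>{1..mm P}. lam i > 0 \<longrightarrow> lam i * gg P i (X k) > 0) \<and>
              (\<forall>i\<in>{1..pp P}. mu i \<noteq> 0 \<longrightarrow> mu i * hh P i (X k) > 0) \<and>
              (\<forall>i\<in>{1..qq P}. etaH i \<noteq> 0 \<longrightarrow> etaH i * HH P i (X k) < 0) \<and>
              (\<forall>i\<in>{1..qq P}. etaG i > 0 \<longrightarrow> etaG i * GG P i (X k) > 0))))"

end

theory Submission
  imports Defs
begin

text \<open>
  Absorbing the minus sign into \<open>-H\<close>, a violation of quasinormality is a family of \<open>C\<^sup>1\<close>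
  functions \<open>F\<^sub>i\<close> vanishing at \<open>a\<close>, nonzero \<open>c\<^sub>i\<close> with \<open>\<Sum>c\<^sub>i\<nabla>F\<^sub>i(a) = 0\<close>, and \<open>x\<^sub>k \<rightarrow> a\<close> with
  \<open>c\<^sub>iF\<^sub>i(x\<^sub>k) > 0\<close>. Shrinking the support as in Caratheodory's theorem, without changing signs,
  one may assume that deleting any one gradient leaves an independent family; the complementarity
  conditions survive because the support only shrinks. CPLD then makes the family
  \<open>\<nabla>F\<^sub>i(x)\<close> dependent for all \<open>x\<close> near \<open>a\<close>, so one \<open>F\<^sub>s\<close> is locally a differentiable function of the
  others, with first-order expansion \<open>c\<^sub>sF\<^sub>s(x) = -\<Sum>c\<^sub>iF\<^sub>i(x) + o(\<Sum>|F\<^sub>i(x)|)\<close> over \<open>i \<noteq> s\<close>. Along \<open>x\<^sub>k\<close>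
  the right-hand side is eventually nonpositive, whereas the left-hand side is positive.
\<close>

section \<open>Sign-preserving reduction to a minimal relation\<close>

text \<open>If the family stays dependent after deleting some \<open>k\<close>, a multiple of the
  smaller relation can be subtracted from \<open>c\<close> until a coefficient first reaches zero.
  The support then shrinks, no coefficient changes sign, and the one at \<open>k\<close> is
  untouched, so the new relation is still nontrivial. Induction on the support finishes.\<close>

lemma ex_support_minimal_relation:
  fixes v :: "'i \<Rightarrow> 'a::real_vector" and c :: "'i \<Rightarrow> real"
  assumes "finite T" "T \<noteq> {}" "\<And>i. i \<in> T \<Longrightarrow> c i \<noteq> 0" "(\<Sum>i\<in>T. c i *\<^sub>R v i) = 0"
  shows "\<exists>S d. S \<subseteq> T \<and> S \<noteq> {} \<and> (\<forall>i\<in>S. d i * c i > 0) \<and> (\<Sum>i\<in>S. d i *\<^sub>R v i) = 0 \<and>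
           (\<forall>k\<in>S. \<forall>a. (\<Sum>i\<in>S - {k}. a i *\<^sub>R v i) = 0 \<longrightarrow> (\<forall>i\<in>S - {k}. a i = 0))"
  using assms
proof (induction T arbitrary: c rule: finite_psubset_induct)
  case (psubset T)
  show ?case
  proof (cases "\<forall>k\<in>T. \<forall>a. (\<Sum>i\<in>T - {k}. a i *\<^sub>R v i) = 0 \<longrightarrow> (\<forall>i\<in>T - {k}. a i = 0)")
    case True
    have "\<forall>i\<in>T. c i * c i > 0"
      using psubset.prems by (simp add: zero_less_mult_iff) (metis linorder_neqE_linordered_idom)
    then show ?thesis
      using True psubset.prems by blast
  next
    case False
    then obtain k a0 j where k: "k \<in> T" "j \<in> T" "j \<noteq> k" "a0 j \<noteq> 0"
      and a0: "(\<Sum>i\<in>T - {k}. a0 i *\<^sub>R v i) = 0"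
      by blast
    \<comment> \<open>The zero at \<open>k\<close> protects the coefficient \<open>c k\<close>. The
      factor \<open>sgn (a0 j * c j)\<close> orients the relation so that it agrees in sign with
      \<open>c\<close> at \<open>j\<close>, which makes \<open>R\<close> below nonempty.\<close>
    define a where "a i = (if i = k then 0 else sgn (a0 j * c j) * a0 i)" for i
    have "(\<Sum>i\<in>T. a i *\<^sub>R v i) = (\<Sum>i\<in>T - {k}. sgn (a0 j * c j) *\<^sub>R (a0 i *\<^sub>R v i))"
      unfolding a_def using k psubset.hyps by (intro sum.mono_neutral_cong_right) auto
    also have "\<dots> = 0"
      by (metis a0 scaleR_sum_right scaleR_zero_right)
    finally have a: "(\<Sum>i\<in>T. a i *\<^sub>R v i) = 0" .
    have "a j * c j = \<bar>a0 j * c j\<bar>"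
      using k by (simp add: a_def sgn_if abs_if)
    then have aj: "a j * c j > 0"
      using k psubset.prems by simp
    define R where "R = {i \<in> T. a i * c i > 0}"
    \<comment> \<open>Subtracting a positive multiple of \<open>a\<close> moves exactly the
      coefficients indexed by \<open>R\<close> towards zero; the minimal ratio \<open>t\<close> is
      the first moment at which one of them vanishes.\<close>
    define t where "t = Min ((\<lambda>i. c i / a i) ` R)"
    have R: "finite R" "R \<noteq> {}"
      using psubset.hyps k aj by (auto simp: R_def)
    then have "t \<in> (\<lambda>i. c i / a i) ` R"
      unfolding t_def by (intro Min_in) auto
    then obtain l where l: "l \<in> R" "t = c l / a l"
      by blast
    have t_le: "t \<le> c i / a i" if "i \<in> R" for i
      unfolding t_def using R that by auto
    have "t > 0"
      using l by (auto simp: R_def zero_less_mult_iff zero_less_divide_iff)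
    define c' where "c' i = c i - t * a i" for i
    define T' where "T' = {i \<in> T. c' i \<noteq> 0}"
    have "c' l = 0" "l \<in> T"
      using l by (auto simp: c'_def R_def)
    then have "T' \<subset> T"
      by (auto simp: T'_def)
    have sgn_c': "c' i * c i \<ge> 0" if "i \<in> T" for i
    proof (cases "a i * c i > 0")
      case True
      then have "t \<le> c i / a i" and ne: "a i \<noteq> 0"
        using t_le that by (auto simp: R_def)
      from this(1) True have "t * (a i * c i) \<le> c i / a i * (a i * c i)"
        by (intro mult_right_mono) auto
      then show ?thesis
        using ne by (simp add: c'_def algebra_simps)
    next
      case False
      then have "t * (a i * c i) \<le> 0"
        using \<open>t > 0\<close> by (simp add: mult_nonneg_nonpos)
      moreover have "c' i * c i = c i * c i - t * (a i * c i)"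
        by (simp add: c'_def algebra_simps)
      ultimately show ?thesis
        by (smt (verit) zero_le_square)
    qed
    have "k \<in> T'"
      using k psubset.prems by (auto simp: T'_def c'_def a_def)
    have "(\<Sum>i\<in>T'. c' i *\<^sub>R v i) = (\<Sum>i\<in>T. c' i *\<^sub>R v i)"
      using psubset.hyps by (intro sum.mono_neutral_left) (auto simp: T'_def)
    also have "\<dots> = (\<Sum>i\<in>T. c i *\<^sub>R v i) - t *\<^sub>R (\<Sum>i\<in>T. a i *\<^sub>R v i)"
      by (simp add: c'_def scaleR_diff_left sum_subtractf scaleR_sum_right)
    also have "\<dots> = 0"
      using a psubset.prems by simp
    finally have rel: "(\<Sum>i\<in>T'. c' i *\<^sub>R v i) = 0" .
    have "T' \<noteq> {}" and c'_ne: "\<And>i. i \<in> T' \<Longrightarrow> c' i \<noteq> 0"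
      using \<open>k \<in> T'\<close> by (auto simp: T'_def)
    from psubset.IH[OF \<open>T' \<subset> T\<close> this rel]
    obtain S d where Sd: "S \<subseteq> T'" "S \<noteq> {}" "\<forall>i\<in>S. d i * c' i > 0" "(\<Sum>i\<in>S. d i *\<^sub>R v i) = 0"
      "\<forall>k\<in>S. \<forall>a. (\<Sum>i\<in>S - {k}. a i *\<^sub>R v i) = 0 \<longrightarrow> (\<forall>i\<in>S - {k}. a i = 0)"
      by blast
    \<comment> \<open>The bound on \<open>c' i * c i\<close> is only nonstrict, but
      \<open>d i * c' i > 0\<close> rules out \<open>c' i = 0\<close> on \<open>S\<close>.\<close>
    have "d i * c i > 0" if "i \<in> S" for i
    proof -
      have "i \<in> T" "d i * c' i > 0"
        using Sd that \<open>T' \<subset> T\<close> by auto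
      then show ?thesis
        using sgn_c'[of i] psubset.prems(2)[of i]
        by (auto simp: zero_less_mult_iff zero_le_mult_iff)
    qed
    then have "\<forall>i\<in>S. d i * c i > 0" by blast
    moreover have "S \<subseteq> T"
      using Sd(1) \<open>T' \<subset> T\<close> by blast
    ultimately show ?thesis
      using Sd(2,4,5) by (intro exI[of _ S] exI[of _ d] conjI)
  qed
qed

section \<open>Dual families and straightening coordinates\<close>

text \<open>Coefficients are attached to indices rather than to vectors, so \<open>v\<close> may
  repeat values. The combinations of this form are a subspace containing every \<open>v i\<close>,
  hence the whole span.\<close>

lemma span_image_sum_representation:
  fixes v :: "'i \<Rightarrow> 'a::real_vector"
  assumes "finite A" "w \<in> span (v ` A)"
  obtains a where "w = (\<Sum>i\<in>A. a i *\<^sub>R v i)"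
proof -
  define R where "R = {w. \<exists>a. w = (\<Sum>i\<in>A. a i *\<^sub>R v i)}"
  have "subspace R"
  proof (rule subspaceI)
    show "0 \<in> R"
      unfolding R_def by (intro CollectI exI[of _ "\<lambda>i. 0"]) simp
  next
    fix x y assume "x \<in> R" "y \<in> R"
    then obtain a b where "x = (\<Sum>i\<in>A. a i *\<^sub>R v i)" "y = (\<Sum>i\<in>A. b i *\<^sub>R v i)"
      by (auto simp: R_def)
    then have "x + y = (\<Sum>i\<in>A. (a i + b i) *\<^sub>R v i)"
      by (simp add: scaleR_add_left sum.distrib)
    then show "x + y \<in> R"
      unfolding R_def by (intro CollectI exI[of _ "\<lambda>i. a i + b i"])
  next
    fix r x assume "x \<in> R"
    then obtain a where "x = (\<Sum>i\<in>A. a i *\<^sub>R v i)"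
      by (auto simp: R_def)
    then have "r *\<^sub>R x = (\<Sum>i\<in>A. (r * a i) *\<^sub>R v i)"
      by (simp add: scaleR_sum_right)
    then show "r *\<^sub>R x \<in> R"
      unfolding R_def by (intro CollectI exI[of _ "\<lambda>i. r * a i"])
  qed
  moreover have "v ` A \<subseteq> R"
  proof
    fix x assume "x \<in> v ` A"
    then obtain j where "j \<in> A" "x = v j"
      by blast
    then have "x = (\<Sum>i\<in>A. (if i = j then 1 else 0) *\<^sub>R v i)"
      using assms(1) by (simp add: if_distrib[of "\<lambda>r. r *\<^sub>R _"] cong: if_cong)
    then show "x \<in> R"
      unfolding R_def by (intro CollectI exI[of _ "\<lambda>i. if i = j then 1 else 0"])
  qed
  ultimately have "w \<in> R"
    using assms(2) span_minimal by blast
  then show ?thesis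
    using that by (auto simp: R_def)
qed

text \<open>The component \<open>z\<close> of \<open>v i\<close> orthogonal to the span of the other
  vectors is nonzero by independence, and its product with \<open>v i\<close> is
  \<open>z \<bullet> z\<close>; rescaling \<open>z\<close> gives \<open>u i\<close>.\<close>

lemma ex_dual_family:
  fixes v :: "'i \<Rightarrow> 'a::euclidean_space"
  assumes "finite S" and indep: "\<And>a. (\<Sum>i\<in>S. a i *\<^sub>R v i) = 0 \<Longrightarrow> \<forall>i\<in>S. a i = 0"
  obtains u where "\<And>i j. i \<in> S \<Longrightarrow> j \<in> S \<Longrightarrow> u i \<bullet> v j = (if i = j then 1 else 0)"
proof -
  have "\<exists>z. \<forall>j\<in>S. z \<bullet> v j = (if i = j then 1 else 0)" if i: "i \<in> S" for i
  proof -
    obtain y z where y: "y \<in> span (v ` (S - {i}))"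
      and z: "\<And>w. w \<in> span (v ` (S - {i})) \<Longrightarrow> orthogonal z w" and vi: "v i = y + z"
      using orthogonal_subspace_decomp_exists by blast
    have "z \<noteq> 0"
    proof
      assume "z = 0"
      then obtain a where a: "v i = (\<Sum>j\<in>S - {i}. a j *\<^sub>R v j)"
        using span_image_sum_representation[OF _ y] assms(1) vi by auto
      have "(\<Sum>j\<in>S. (if j = i then - 1 else a j) *\<^sub>R v j)
          = - v i + (\<Sum>j\<in>S - {i}. a j *\<^sub>R v j)"
        using assms(1) i by (simp add: sum.remove)
      then show False
        using indep[of "\<lambda>j. if j = i then - 1 else a j"] a i by auto
    qed
    moreover have "z \<bullet> v i = z \<bullet> z"
      using z[OF y] by (simp add: vi inner_add_right orthogonal_def)
    moreover have "z \<bullet> v j = 0" if "j \<in> S - {i}" for j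
      using z[of "v j"] that by (simp add: span_base orthogonal_def)
    ultimately have "\<forall>j\<in>S. (z /\<^sub>R (z \<bullet> z)) \<bullet> v j = (if i = j then 1 else 0)"
      by auto
    then show ?thesis by blast
  qed
  then show ?thesis
    using that by metis
qed

text \<open>The map \<Phi> adds to the identity the first-order remainders of the \<open>f i\<close>
  at \<open>a\<close>, in the directions \<open>u i\<close>. These remainders have derivative zero
  at \<open>a\<close>, so \<Phi> has the identity as derivative there and the inverse function
  theorem applies.\<close>

lemma straightening_chart:
  fixes f :: "'i \<Rightarrow> 'a::euclidean_space \<Rightarrow> real"
  assumes "finite S"
    and der: "\<And>i x. i \<in> S \<Longrightarrow> GDERIV (f i) x :> D i x"
    and cont: "\<And>i. i \<in> S \<Longrightarrow> continuous_on UNIV (D i)"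
    and zero: "\<And>i. i \<in> S \<Longrightarrow> f i a = 0"
    and dual: "\<And>i j. i \<in> S \<Longrightarrow> j \<in> S \<Longrightarrow> u i \<bullet> D j a = (if i = j then 1 else 0)"
  obtains U V \<Phi> \<Psi> where "open U" "open V" "a \<in> U" "homeomorphism U V \<Phi> \<Psi>" "\<Phi> a = a"
    "\<And>j x. j \<in> S \<Longrightarrow> f j x = D j a \<bullet> (\<Phi> x - a)"
    "(\<Psi> has_derivative (\<lambda>h. h)) (at a)" "\<And>z. z \<in> V \<Longrightarrow> \<exists>\<Psi>'. (\<Psi> has_derivative \<Psi>') (at z)"
proof -
  txt \<open>Duality of \<open>u\<close> makes \<open>f j\<close> linear in the coordinates \<open>\<Phi>\<close>.\<close>
  define \<Phi> where "\<Phi> x = x + (\<Sum>i\<in>S. (f i x - D i a \<bullet> (x - a)) *\<^sub>R u i)" for x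
  \<comment> \<open>The derivative is written as a bounded linear map because the inverse function
    theorem asks for its continuity in operator norm.\<close>
  define \<Phi>' where "\<Phi>' x = id_blinfun
    + (\<Sum>i\<in>S. blinfun_scaleR_left (u i) o\<^sub>L blinfun_inner_left (D i x - D i a))" for x
  have apply_\<Phi>': "blinfun_apply (\<Phi>' x) h = h + (\<Sum>i\<in>S. (h \<bullet> D i x - D i a \<bullet> h) *\<^sub>R u i)" for x h
    by (simp add: \<Phi>'_def blinfun.add_left blinfun.sum_left inner_diff_left inner_diff_right inner_commute)
  have der_\<Phi>: "(\<Phi> has_derivative blinfun_apply (\<Phi>' x)) (at x)" for x
  proof -
    have "(\<Phi> has_derivative (\<lambda>h. h + (\<Sum>i\<in>S. (h \<bullet> D i x - D i a \<bullet> h) *\<^sub>R u i))) (at x)"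
      unfolding \<Phi>_def
      using der[unfolded gderiv_def]
      by (auto intro!: derivative_eq_intros sum.cong)
    moreover have "(\<lambda>h. h + (\<Sum>i\<in>S. (h \<bullet> D i x - D i a \<bullet> h) *\<^sub>R u i)) = blinfun_apply (\<Phi>' x)"
      by (simp add: apply_\<Phi>' fun_eq_iff)
    ultimately show ?thesis by simp
  qed
  have cont_\<Phi>': "continuous_on UNIV \<Phi>'"
    unfolding \<Phi>'_def using cont by (auto intro!: continuous_intros)
  have \<Phi>'_a: "\<Phi>' a = id_blinfun"
    by (rule blinfun_eqI) (simp add: apply_\<Phi>' inner_commute)
  have "id_blinfun o\<^sub>L \<Phi>' a = id_blinfun"
    by (rule blinfun_eqI) (simp add: \<Phi>'_a)
  from inverse_function_theorem[OF open_UNIV der_\<Phi> cont_\<Phi>' UNIV_I this]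
  obtain U V \<Psi> \<Psi>' where UV: "open U" "a \<in> U" "open V" "homeomorphism U V \<Phi> \<Psi>"
    and der_\<Psi>: "\<And>y. y \<in> V \<Longrightarrow> (\<Psi> has_derivative \<Psi>' y) (at y)"
    and \<Psi>': "\<And>y. y \<in> V \<Longrightarrow> \<Psi>' y = inv (blinfun_apply (\<Phi>' (\<Psi> y)))"
    and "\<Phi> a \<in> V"
    by metis
  have \<Phi>_a: "\<Phi> a = a"
    using zero by (simp add: \<Phi>_def)
  have "a \<in> V" "\<Psi> a = a"
    using UV \<Phi>_a by (auto simp: homeomorphism_def) (metis image_eqI)+
  have "\<Psi>' a = (\<lambda>h. h)"
    using \<Psi>'[OF \<open>a \<in> V\<close>] \<open>\<Psi> a = a\<close> \<Phi>'_a by (simp add: inv_id[unfolded id_def] id_blinfun.rep_eq)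
  then have "(\<Psi> has_derivative (\<lambda>h. h)) (at a)"
    using der_\<Psi>[OF \<open>a \<in> V\<close>] by simp
  moreover have "f j x = D j a \<bullet> (\<Phi> x - a)" if j: "j \<in> S" for j x
  proof -
    have "(\<Sum>i\<in>S. (f i x - D i a \<bullet> (x - a)) * (u i \<bullet> D j a))
        = (\<Sum>i\<in>S. if i = j then f i x - D i a \<bullet> (x - a) else 0)"
      using j by (intro sum.cong) (auto simp: dual)
    also have "\<dots> = f j x - D j a \<bullet> (x - a)"
      using j assms(1) by simp
    finally show ?thesis
      by (simp add: \<Phi>_def inner_add_right inner_diff_right inner_sum_right inner_commute)
  qed
  ultimately show ?thesis
    using that UV \<Phi>_a der_\<Psi> by blast
qed

section \<open>First-order expansion under persistent dependence\<close>

text \<open>A constant-rank argument. In the chart, \<open>f0\<close> becomes a function \<phi>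
  whose derivative vanishes on every direction orthogonal to all \<open>D j a\<close>, so \<phi> is
  constant along such segments. Near \<open>a\<close>, \<open>f0 x\<close> is thus determined by the
  values \<open>f i x\<close>, and differentiability of \<phi> at \<open>a\<close> gives an error
  small relative to the sum of their absolute values.\<close>

lemma dependent_gradients_first_order:
  fixes f :: "'i \<Rightarrow> 'a::euclidean_space \<Rightarrow> real" and f0 :: "'a \<Rightarrow> real"
  assumes "finite S"
    and der: "\<And>i x. i \<in> S \<Longrightarrow> GDERIV (f i) x :> D i x"
    and cont: "\<And>i. i \<in> S \<Longrightarrow> continuous_on UNIV (D i)"
    and zero: "\<And>i. i \<in> S \<Longrightarrow> f i a = 0"
    and indep: "\<And>c. (\<Sum>i\<in>S. c i *\<^sub>R D i a) = 0 \<Longrightarrow> \<forall>i\<in>S. c i = 0"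
    and der0: "\<And>x. GDERIV f0 x :> D0 x" and zero0: "f0 a = 0"
    and D0_a: "D0 a = (\<Sum>i\<in>S. d i *\<^sub>R D i a)"
    and "open W" "a \<in> W"
    and dep: "\<And>x. x \<in> W \<Longrightarrow> \<exists>c0 c. (c0 \<noteq> 0 \<or> (\<exists>i\<in>S. c i \<noteq> 0)) \<and>
                c0 *\<^sub>R D0 x + (\<Sum>i\<in>S. c i *\<^sub>R D i x) = 0"
    and "e > 0"
  shows "\<forall>\<^sub>F x in nhds a. \<bar>f0 x - (\<Sum>i\<in>S. d i * f i x)\<bar> \<le> e * (\<Sum>i\<in>S. \<bar>f i x\<bar>)"
proof -
  obtain u where dual: "\<And>i j. i \<in> S \<Longrightarrow> j \<in> S \<Longrightarrow> u i \<bullet> D j a = (if i = j then 1 else 0)"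
    using ex_dual_family[OF assms(1) indep] by metis
  obtain U V \<Phi> \<Psi> where UV: "open U" "open V" "a \<in> U" "homeomorphism U V \<Phi> \<Psi>" "\<Phi> a = a"
    and f_\<Phi>: "\<And>j x. j \<in> S \<Longrightarrow> f j x = D j a \<bullet> (\<Phi> x - a)"
    and der_\<Psi>_a: "(\<Psi> has_derivative (\<lambda>h. h)) (at a)"
    and der_\<Psi>: "\<And>z. z \<in> V \<Longrightarrow> \<exists>\<Psi>'. (\<Psi> has_derivative \<Psi>') (at z)"
    using straightening_chart[of S f D a u, OF assms(1) der cont zero dual] by metis
  have "a \<in> V" "\<Psi> a = a"
    using UV by (auto simp: homeomorphism_def) (metis image_eqI)+
  have cont_\<Phi>: "continuous_on U \<Phi>" and cont_\<Psi>: "continuous_on V \<Psi>"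
    and \<Psi>_\<Phi>: "\<And>x. x \<in> U \<Longrightarrow> \<Psi> (\<Phi> x) = x" and \<Phi>_\<Psi>: "\<And>z. z \<in> V \<Longrightarrow> \<Phi> (\<Psi> z) = z"
    using UV by (auto simp: homeomorphism_def)
  have "open (V \<inter> \<Psi> -` W)"
    using continuous_open_preimage[OF cont_\<Psi>] UV \<open>open W\<close> by blast
  moreover have "a \<in> V \<inter> \<Psi> -` W"
    using \<open>a \<in> V\<close> \<open>\<Psi> a = a\<close> \<open>a \<in> W\<close> by simp
  \<comment> \<open>A ball is chosen for its convexity: the segments along which \<phi> is shown to
    be constant remain inside it.\<close>
  ultimately obtain r where "r > 0" and r: "ball a r \<subseteq> V \<inter> \<Psi> -` W"
    using openE by blast
  define \<phi> where "\<phi> z = f0 (\<Psi> z)" for z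
  have der_\<phi>: "\<exists>\<phi>'. (\<phi> has_derivative \<phi>') (at z) \<and> (\<forall>w. (\<forall>j\<in>S. D j a \<bullet> w = 0) \<longrightarrow> \<phi>' w = 0)"
    if z: "z \<in> ball a r" for z
  proof -
    have "z \<in> V" "\<Psi> z \<in> W"
      using z r by auto
    obtain \<Psi>' where \<Psi>': "(\<Psi> has_derivative \<Psi>') (at z)"
      using der_\<Psi> \<open>z \<in> V\<close> by blast
    have \<phi>': "(\<phi> has_derivative (\<lambda>h. \<Psi>' h \<bullet> D0 (\<Psi> z))) (at z)"
      using has_derivative_compose[OF \<Psi>' der0[unfolded gderiv_def]] by (simp add: \<phi>_def[abs_def])
    \<comment> \<open>On \<open>V\<close> the composite of \<open>f j\<close> with \<Psi> is affine
      with gradient \<open>D j a\<close>, so the chain rule yields this value at every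
      \<open>z\<close>, not only at \<open>a\<close>.\<close>
    have chain: "\<Psi>' h \<bullet> D j (\<Psi> z) = D j a \<bullet> h" if "j \<in> S" for j h
    proof -
      have "((\<lambda>z. f j (\<Psi> z)) has_derivative (\<lambda>h. \<Psi>' h \<bullet> D j (\<Psi> z))) (at z)"
        using has_derivative_compose[OF \<Psi>' der[OF that, unfolded gderiv_def]] by simp
      moreover have "((\<lambda>z. D j a \<bullet> (z - a)) has_derivative (\<lambda>h. D j a \<bullet> h)) (at z)"
        by (auto intro!: derivative_eq_intros)
      then have "((\<lambda>z. f j (\<Psi> z)) has_derivative (\<lambda>h. D j a \<bullet> h)) (at z)"
        by (rule has_derivative_transform_within_open[OF _ \<open>open V\<close> \<open>z \<in> V\<close>])
          (simp add: f_\<Phi>[OF that] \<Phi>_\<Psi>)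
      ultimately show ?thesis
        by (metis has_derivative_unique)
    qed
    obtain c0 c where c: "c0 \<noteq> 0 \<or> (\<exists>i\<in>S. c i \<noteq> 0)"
      "c0 *\<^sub>R D0 (\<Psi> z) + (\<Sum>i\<in>S. c i *\<^sub>R D i (\<Psi> z)) = 0"
      using dep[OF \<open>\<Psi> z \<in> W\<close>] by blast
    have rel: "c0 * (\<Psi>' h \<bullet> D0 (\<Psi> z)) + (\<Sum>i\<in>S. c i * (D i a \<bullet> h)) = 0" for h
    proof -
      have "\<Psi>' h \<bullet> (c0 *\<^sub>R D0 (\<Psi> z) + (\<Sum>i\<in>S. c i *\<^sub>R D i (\<Psi> z))) = 0"
        by (simp add: c)
      then show ?thesis
        by (simp add: inner_add_right inner_sum_right chain)
    qed
    \<comment> \<open>Otherwise the chart carries the dependence at \<open>\<Psi> z\<close> back to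
      the same relation among the \<open>D i a\<close>, against independence at
      \<open>a\<close>.\<close>
    have "c0 \<noteq> 0"
    proof
      assume "c0 = 0"
      then have "(\<Sum>i\<in>S. c i *\<^sub>R D i a) \<bullet> h = 0" for h
        using rel[of h] by (simp add: inner_sum_left)
      then have "(\<Sum>i\<in>S. c i *\<^sub>R D i a) = 0"
        by (metis inner_eq_zero_iff)
      then show False
        using indep c \<open>c0 = 0\<close> by blast
    qed
    then have "\<Psi>' w \<bullet> D0 (\<Psi> z) = 0" if "\<forall>j\<in>S. D j a \<bullet> w = 0" for w
      using rel[of w] that by simp
    then show ?thesis
      using \<phi>' by blast
  qed
  have \<phi>_eq: "\<phi> z = \<phi> z'"
    if z: "z \<in> ball a r" "z' \<in> ball a r" and orth: "\<forall>j\<in>S. D j a \<bullet> (z - z') = 0" for z z'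
  proof -
    define \<gamma> where "\<gamma> t = z' + t *\<^sub>R (z - z')" for t :: real
    have "((\<lambda>t. \<phi> (\<gamma> t)) has_derivative (\<lambda>h. 0)) (at t within {0..1})" if t: "t \<in> {0..1}" for t
    proof -
      have "\<gamma> t = (1 - t) *\<^sub>R z' + t *\<^sub>R z"
        by (simp add: \<gamma>_def algebra_simps)
      then have "\<gamma> t \<in> ball a r"
        using convexD[OF convex_ball z(2) z(1), of "1 - t" t] t by simp
      then obtain \<phi>' where \<phi>': "(\<phi> has_derivative \<phi>') (at (\<gamma> t))" "\<phi>' (z - z') = 0"
        using der_\<phi> orth by blast
      have "(\<gamma> has_derivative (\<lambda>h. h *\<^sub>R (z - z'))) (at t within {0..1})"
        unfolding \<gamma>_def by (auto intro!: derivative_eq_intros)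
      from has_derivative_compose[OF this \<phi>'(1)] 
      have "((\<lambda>t. \<phi> (\<gamma> t)) has_derivative (\<lambda>h. \<phi>' (h *\<^sub>R (z - z')))) (at t within {0..1})" .
      then show ?thesis
        using \<phi>' by (simp add: linear_cmul[OF has_derivative_linear[OF \<phi>'(1)]])
    qed
    then have "\<phi> (\<gamma> 1) = \<phi> (\<gamma> 0)"
      by (intro has_derivative_zero_unique[of "{0..1}"]) auto
    then show ?thesis by (simp add: \<gamma>_def)
  qed
  \<comment> \<open>This constant bounds \<open>norm (\<pi> x - a)\<close> in terms of the sum of
    the absolute values of the \<open>f i x\<close>. The later use of \<open>M + 1\<close> keeps the
    divisor positive even when \<open>S\<close> is empty.\<close>
  define M where "M = (\<Sum>i\<in>S. norm (u i))"
  have "M \<ge> 0"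
    by (simp add: M_def sum_nonneg)
  have "(f0 has_derivative (\<lambda>h. h \<bullet> D0 a)) (at (\<Psi> a))"
    using der0[of a] by (simp add: gderiv_def \<open>\<Psi> a = a\<close>)
  from has_derivative_compose[OF der_\<Psi>_a this]
  have "(\<phi> has_derivative (\<lambda>h. h \<bullet> D0 a)) (at a)"
    by (simp add: \<phi>_def[abs_def])
  moreover have "e / (M + 1) > 0"
    using \<open>e > 0\<close> \<open>M \<ge> 0\<close> by simp
  ultimately obtain \<delta> where "\<delta> > 0"
    and \<delta>: "\<And>y. norm (y - a) < \<delta> \<Longrightarrow>
      norm (\<phi> y - \<phi> a - (y - a) \<bullet> D0 a) \<le> e / (M + 1) * norm (y - a)"
    unfolding has_derivative_at_alt by blast
  have \<phi>_a: "\<phi> a = 0"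
    by (simp add: \<phi>_def \<open>\<Psi> a = a\<close> zero0)
  txt \<open>In the chart \<open>\<Phi>\<close>, this is the projection onto the span of the \<open>u i\<close> along the directions in
    which \<open>\<phi>\<close> is constant.\<close>
  define \<pi> where "\<pi> x = a + (\<Sum>i\<in>S. f i x *\<^sub>R u i)" for x
  have "continuous (at a) (f i)" if "i \<in> S" for i
    using der[OF that, of a] has_derivative_continuous unfolding gderiv_def by blast
  then have "continuous (at a) \<pi>"
    unfolding \<pi>_def by (intro continuous_intros) auto
  moreover have "\<pi> a = a"
    by (simp add: \<pi>_def zero)
  ultimately have lim_\<pi>: "(\<pi> \<longlongrightarrow> a) (nhds a)"
    by (metis continuous_at_imp_continuous_at_within continuous_within tendsto_at_iff_tendsto_nhds)
  have "continuous (at a) \<Phi>"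
    using cont_\<Phi> UV continuous_on_eq_continuous_at by blast
  then have lim_\<Phi>: "(\<Phi> \<longlongrightarrow> a) (nhds a)"
    by (metis UV(5) continuous_within tendsto_at_iff_tendsto_nhds)
  have "\<forall>\<^sub>F x in nhds a. x \<in> U"
    using UV by (simp add: eventually_nhds_in_open)
  moreover have "\<forall>\<^sub>F x in nhds a. \<Phi> x \<in> ball a r"
    using tendstoD[OF lim_\<Phi> \<open>r > 0\<close>] by (simp add: dist_commute)
  moreover have "\<forall>\<^sub>F x in nhds a. \<pi> x \<in> ball a r"
    using tendstoD[OF lim_\<pi> \<open>r > 0\<close>] by (simp add: dist_commute)
  moreover have "\<forall>\<^sub>F x in nhds a. norm (\<pi> x - a) < \<delta>"
    using tendstoD[OF lim_\<pi> \<open>\<delta> > 0\<close>] by (simp add: dist_norm)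
  ultimately show ?thesis
  proof eventually_elim
    case (elim x)
    have "D j a \<bullet> (\<Phi> x - \<pi> x) = 0" if j: "j \<in> S" for j
    proof -
      have "D j a \<bullet> (\<Sum>i\<in>S. f i x *\<^sub>R u i) = (\<Sum>i\<in>S. if i = j then f i x else 0)"
        unfolding inner_sum_right
        using j dual by (intro sum.cong) (auto simp: inner_commute)
      also have "\<dots> = f j x"
        using j assms(1) by simp
      finally show ?thesis
        using f_\<Phi>[OF j, of x] by (simp add: \<pi>_def inner_diff_right inner_add_right)
    qed
    then have "\<phi> (\<Phi> x) = \<phi> (\<pi> x)"
      using \<phi>_eq elim by blast
    then have f0_x: "f0 x = \<phi> (\<pi> x)"
      using elim \<Psi>_\<Phi> by (simp add: \<phi>_def)
    \<comment> \<open>Pairing the expansion of \<open>D0 a\<close> with the dual vector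
      \<open>u i\<close> recovers its coefficient, so the linear term of \<phi> at
      \<open>\<pi> x\<close> is the expected combination.\<close>
    have "u i \<bullet> D0 a = d i" if "i \<in> S" for i
    proof -
      have "u i \<bullet> D0 a = (\<Sum>j\<in>S. if j = i then d j else 0)"
        unfolding D0_a inner_sum_right using that dual by (intro sum.cong) auto
      then show ?thesis
        using that assms(1) by simp
    qed
    then have lin: "(\<pi> x - a) \<bullet> D0 a = (\<Sum>i\<in>S. d i * f i x)"
      by (simp add: \<pi>_def inner_sum_left mult.commute)
    have "norm (\<pi> x - a) \<le> (\<Sum>i\<in>S. \<bar>f i x\<bar> * norm (u i))"
      unfolding \<pi>_def by (simp add: sum_norm_le)
    also have "\<dots> \<le> (\<Sum>i\<in>S. \<bar>f i x\<bar> * M)"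
      unfolding M_def using assms(1) by (intro sum_mono mult_left_mono member_le_sum) auto
    also have "\<dots> \<le> (\<Sum>i\<in>S. \<bar>f i x\<bar>) * (M + 1)"
      by (simp add: sum_distrib_right distrib_left sum.distrib sum_nonneg)
    finally have "e / (M + 1) * norm (\<pi> x - a) \<le> e / (M + 1) * ((\<Sum>i\<in>S. \<bar>f i x\<bar>) * (M + 1))"
      using \<open>e / (M + 1) > 0\<close> by (intro mult_left_mono) auto
    also have "\<dots> = e * (\<Sum>i\<in>S. \<bar>f i x\<bar>)"
      using \<open>M \<ge> 0\<close> by simp
    finally show ?case
      using \<delta>[of "\<pi> x"] elim by (simp add: f0_x lin \<phi>_a)
  qed
qed

section \<open>The contradiction for a single family of functions\<close>

text \<open>The hypothesis \<open>cpld\<close> is imposed only for relations whose signs agree with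
  \<open>c\<close> on a subset of \<open>T\<close>, which is what the reduction to a minimal
  relation produces. Singling out one function \<open>F s\<close> of that relation, the expansion
  forces \<open>d s * F s (X k)\<close> to be at most zero for some \<open>k\<close>, although it is
  positive.\<close>

lemma no_positive_relation_of_cpld:
  fixes F :: "'i \<Rightarrow> 'a::euclidean_space \<Rightarrow> real"
  assumes "finite T" "T \<noteq> {}"
    and der: "\<And>i x. i \<in> T \<Longrightarrow> GDERIV (F i) x :> D i x"
    and cont: "\<And>i. i \<in> T \<Longrightarrow> continuous_on UNIV (D i)"
    and zero: "\<And>i. i \<in> T \<Longrightarrow> F i a = 0"
    and c: "\<And>i. i \<in> T \<Longrightarrow> c i \<noteq> 0" "(\<Sum>i\<in>T. c i *\<^sub>R D i a) = 0"
    and cpld: "\<And>S d. S \<subseteq> T \<Longrightarrow> S \<noteq> {} \<Longrightarrow> (\<And>i. i \<in> S \<Longrightarrow> d i * c i > 0) \<Longrightarrow>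
        (\<Sum>i\<in>S. d i *\<^sub>R D i a) = 0 \<Longrightarrow>
        \<exists>W. open W \<and> a \<in> W \<and> (\<forall>x\<in>W. \<exists>b. (\<exists>i\<in>S. b i \<noteq> 0) \<and> (\<Sum>i\<in>S. b i *\<^sub>R D i x) = 0)"
    and X: "X \<longlonglongrightarrow> a" and pos: "\<And>i k. i \<in> T \<Longrightarrow> c i * F i (X k) > 0"
  shows False
proof -
  from ex_support_minimal_relation[OF assms(1,2) c]
  obtain S d where S: "S \<subseteq> T" "S \<noteq> {}" and d: "\<forall>i\<in>S. d i * c i > 0" "(\<Sum>i\<in>S. d i *\<^sub>R D i a) = 0"
    and minimal: "\<forall>k\<in>S. \<forall>b. (\<Sum>i\<in>S - {k}. b i *\<^sub>R D i a) = 0 \<longrightarrow> (\<forall>i\<in>S - {k}. b i = 0)"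
    by blast
  have "finite S"
    using S assms(1) finite_subset by blast
  obtain W where W: "open W" "a \<in> W"
    and dep: "\<And>x. x \<in> W \<Longrightarrow> \<exists>b. (\<exists>i\<in>S. b i \<noteq> 0) \<and> (\<Sum>i\<in>S. b i *\<^sub>R D i x) = 0"
    using cpld[OF S _ d(2)] d(1) by blast
  have pos_d: "d i * F i (X k) > 0" if "i \<in> S" for i k
    using d(1) pos[of i k] that S(1) by (force simp: zero_less_mult_iff)
  obtain s where "s \<in> S"
    using S by blast
  define R where "R = S - {s}"
  have R: "finite R" "R \<subseteq> T" "s \<in> T" "S = insert s R" "s \<notin> R"
    using \<open>finite S\<close> \<open>s \<in> S\<close> S by (auto simp: R_def)
  have "d s \<noteq> 0"
    using d(1) \<open>s \<in> S\<close> by force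
  have "d s *\<^sub>R D s a = - (\<Sum>i\<in>R. d i *\<^sub>R D i a)"
    using d(2) R by (simp add: add_eq_0_iff2)
  then have "(1 / d s) *\<^sub>R (d s *\<^sub>R D s a) = (1 / d s) *\<^sub>R - (\<Sum>i\<in>R. d i *\<^sub>R D i a)"
    by simp
  then have D_s: "D s a = (\<Sum>i\<in>R. (- d i / d s) *\<^sub>R D i a)"
    using \<open>d s \<noteq> 0\<close> by (simp add: scaleR_sum_right sum_negf)
  have dep': "\<exists>b0 b. (b0 \<noteq> 0 \<or> (\<exists>i\<in>R. b i \<noteq> 0)) \<and>
      b0 *\<^sub>R D s x + (\<Sum>i\<in>R. b i *\<^sub>R D i x) = 0" if x: "x \<in> W" for x
  proof -
    obtain b where "\<exists>i\<in>S. b i \<noteq> 0" "(\<Sum>i\<in>S. b i *\<^sub>R D i x) = 0"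
      using dep[OF x] by blast
    then show ?thesis
      using R by (intro exI[of _ "b s"] exI[of _ b]) auto
  qed
  \<comment> \<open>The tolerance \<open>e\<close> below satisfies
    \<open>\<bar>d s\<bar> * e = m\<close>. Since \<open>m\<close> is at most every
    \<open>\<bar>d i\<bar>\<close>, the error term is absorbed by the sum of the positive terms
    \<open>d i * F i (X k)\<close> over \<open>R\<close>.\<close>
  define m where "m = Min ((\<lambda>i. \<bar>d i\<bar>) ` S)"
  have m: "m \<le> \<bar>d i\<bar>" if "i \<in> S" for i
    unfolding m_def using that \<open>finite S\<close> by simp
  have "m \<in> (\<lambda>i. \<bar>d i\<bar>) ` S"
    unfolding m_def using \<open>finite S\<close> S by (intro Min_in) auto
  then have "m > 0"
    using d(1) by force
  define e where "e = m / \<bar>d s\<bar>"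
  have "e > 0"
    using \<open>m > 0\<close> \<open>d s \<noteq> 0\<close> by (simp add: e_def)
  have "\<forall>\<^sub>F x in nhds a. \<bar>F s x - (\<Sum>i\<in>R. (- d i / d s) * F i x)\<bar> \<le> e * (\<Sum>i\<in>R. \<bar>F i x\<bar>)"
  proof (rule dependent_gradients_first_order[where D = D and ?D0.0 = "D s" and W = W])
    \<comment> \<open>This is where minimality enters, with \<open>s\<close> as the deleted
      index.\<close>
    show "\<forall>i\<in>R. b i = 0" if "(\<Sum>i\<in>R. b i *\<^sub>R D i a) = 0" for b
      using minimal \<open>s \<in> S\<close> that unfolding R_def by blast
  qed (use R W D_s dep' \<open>e > 0\<close> der cont zero in auto)
  then have "\<forall>\<^sub>F k in sequentially. \<bar>F s (X k) - (\<Sum>i\<in>R. (- d i / d s) * F i (X k))\<bar>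
      \<le> e * (\<Sum>i\<in>R. \<bar>F i (X k)\<bar>)"
    by (rule eventually_compose_filterlim[OF _ X])
  from eventually_happens'[OF sequentially_bot this] obtain k where k: "\<bar>F s (X k) - (\<Sum>i\<in>R. (- d i / d s) * F i (X k))\<bar>
      \<le> e * (\<Sum>i\<in>R. \<bar>F i (X k)\<bar>)"
    by blast
  have abs_d: "\<bar>d i\<bar> * \<bar>F i (X k)\<bar> = d i * F i (X k)" if "i \<in> S" for i
    using pos_d[OF that, of k] by (metis abs_mult abs_of_pos)
  have "d s * (F s (X k) - (\<Sum>i\<in>R. (- d i / d s) * F i (X k)))
      = d s * F s (X k) + (\<Sum>i\<in>R. d i * F i (X k))"
    using \<open>d s \<noteq> 0\<close> by (simp add: right_diff_distrib distrib_left sum_distrib_left sum_negf)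
  then have "d s * F s (X k) + (\<Sum>i\<in>R. d i * F i (X k))
      \<le> \<bar>d s\<bar> * \<bar>F s (X k) - (\<Sum>i\<in>R. (- d i / d s) * F i (X k))\<bar>"
    unfolding abs_mult[symmetric] by simp
  also have "\<dots> \<le> \<bar>d s\<bar> * (e * (\<Sum>i\<in>R. \<bar>F i (X k)\<bar>))"
    by (intro mult_left_mono k) simp
  also have "\<dots> = (\<Sum>i\<in>R. m * \<bar>F i (X k)\<bar>)"
    using \<open>d s \<noteq> 0\<close> by (simp add: e_def sum_distrib_left)
  also have "\<dots> \<le> (\<Sum>i\<in>R. \<bar>d i\<bar> * \<bar>F i (X k)\<bar>)"
    using m R by (intro sum_mono mult_right_mono) auto
  also have "\<dots> = (\<Sum>i\<in>R. d i * F i (X k))"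
    using abs_d R by (intro sum.cong) auto
  finally show False
    using pos_d[OF \<open>s \<in> S\<close>, of k] by simp
qed

section \<open>Translation to vanishing constraints\<close>

text \<open>Applied three times, this splits a sum over the nested sum type into the four sums over
  indices of \<open>g\<close>, \<open>h\<close>, \<open>G\<close> and \<open>H\<close>.\<close>

lemma sum_vimage_Inl_Inr:
  assumes "finite S"
  shows "sum f S = (\<Sum>i\<in>Inl -` S. f (Inl i)) + (\<Sum>j\<in>Inr -` S. f (Inr j))"
proof -
  have "finite (Inl -` S)" "finite (Inr -` S)"
    using assms by (simp_all add: finite_vimageI)
  moreover have "S = Inl -` S <+> Inr -` S"
  proof (rule set_eqI)
    show "x \<in> S \<longleftrightarrow> x \<in> Inl -` S <+> Inr -` S" for x
      by (cases x) auto
  qed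
  ultimately have "sum f S = sum (f \<circ> Inl) (Inl -` S) + sum (f \<circ> Inr) (Inr -` S)"
    by (metis sum.Plus)
  then show ?thesis
    by (simp add: comp_def)
qed

theorem theorem4p5:
  fixes P :: "'n::finite mpvc" and xs :: "real^'n"
  assumes "mpvc_C1 P"
    and "xs \<in> feasible_set P"
    and "MPVC_CPLD P xs"
  shows "MPVC_generalized_quasinormality P xs"
  unfolding MPVC_generalized_quasinormality_def
proof (rule notI, elim exE conjE)
  fix lam mu etaG etaH :: "nat \<Rightarrow> real" and X :: "nat \<Rightarrow> real^'n"
  assume nonzero: "(\<exists>i\<in>{1..mm P}. lam i \<noteq> 0) \<or> (\<exists>i\<in>{1..pp P}. mu i \<noteq> 0) \<or>
      (\<exists>i\<in>{1..qq P}. etaG i \<noteq> 0) \<or> (\<exists>i\<in>{1..qq P}. etaH i \<noteq> 0)"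
    and rel: "(\<Sum>i=1..mm P. lam i *\<^sub>R grad (gg P i) xs) + (\<Sum>i=1..pp P. mu i *\<^sub>R grad (hh P i) xs)
          + (\<Sum>i=1..qq P. etaG i *\<^sub>R grad (GG P i) xs)
          - (\<Sum>i=1..qq P. etaH i *\<^sub>R grad (HH P i) xs) = 0"
    and lam: "\<forall>i\<in>I_g P xs. lam i \<ge> 0" "\<forall>i\<in>{1..mm P} - I_g P xs. lam i = 0"
    and etaG: "\<forall>i\<in>I_pm P xs \<union> I_0m P xs \<union> I_0p P xs. etaG i = 0"
      "\<forall>i\<in>I_p0 P xs \<union> I_00 P xs. etaG i \<ge> 0"
    and etaH: "\<forall>i\<in>I_p P xs. etaH i = 0"
    and compl: "\<forall>i\<in>I_00 P xs. etaH i * etaG i = 0"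
    and X: "X \<longlonglongrightarrow> xs"
    and signs: "\<forall>k. (\<forall>i\<in>{1..mm P}. lam i > 0 \<longrightarrow> lam i * gg P i (X k) > 0) \<and>
              (\<forall>i\<in>{1..pp P}. mu i \<noteq> 0 \<longrightarrow> mu i * hh P i (X k) > 0) \<and>
              (\<forall>i\<in>{1..qq P}. etaH i \<noteq> 0 \<longrightarrow> etaH i * HH P i (X k) < 0) \<and>
              (\<forall>i\<in>{1..qq P}. etaG i > 0 \<longrightarrow> etaG i * GG P i (X k) > 0)"
  \<comment> \<open>The four kinds of constraint become one family over a nested sum type. Negating
    \<open>H\<close> turns the multiplier equation into a plain sum and the sign conditions along
    \<open>X\<close> into the uniform \<open>c i * F i (X k) > 0\<close>.\<close>
  define F where "F = case_sum (gg P) (case_sum (hh P) (case_sum (GG P) (\<lambda>i x. - HH P i x)))"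
  define D where "D = case_sum (\<lambda>i. grad (gg P i)) (case_sum (\<lambda>i. grad (hh P i))
    (case_sum (\<lambda>i. grad (GG P i)) (\<lambda>i x. - grad (HH P i) x)))"
  define c where "c = case_sum lam (case_sum mu (case_sum etaG etaH))"
  define N where "N = {1..mm P} <+> {1..pp P} <+> {1..qq P} <+> {1..qq P}"
  define T where "T = {i \<in> N. c i \<noteq> 0}"
  have "finite N"
    by (simp add: N_def)
  then have "finite T"
    by (simp add: T_def)
  have inN: "Inl i \<in> N \<longleftrightarrow> i \<in> {1..mm P}" "Inr (Inl i) \<in> N \<longleftrightarrow> i \<in> {1..pp P}"
    "Inr (Inr (Inl i)) \<in> N \<longleftrightarrow> i \<in> {1..qq P}" "Inr (Inr (Inr i)) \<in> N \<longleftrightarrow> i \<in> {1..qq P}" for i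
    by (auto simp: N_def)
  have inT: "Inl i \<in> T \<longleftrightarrow> i \<in> {1..mm P} \<and> lam i \<noteq> 0"
    "Inr (Inl i) \<in> T \<longleftrightarrow> i \<in> {1..pp P} \<and> mu i \<noteq> 0"
    "Inr (Inr (Inl i)) \<in> T \<longleftrightarrow> i \<in> {1..qq P} \<and> etaG i \<noteq> 0"
    "Inr (Inr (Inr i)) \<in> T \<longleftrightarrow> i \<in> {1..qq P} \<and> etaH i \<noteq> 0" for i
    unfolding T_def using inN[of i] by (auto simp: c_def)
  have casesT: "(\<exists>i. k = Inl i \<and> i \<in> {1..mm P} \<and> lam i \<noteq> 0) \<or>
      (\<exists>i. k = Inr (Inl i) \<and> i \<in> {1..pp P} \<and> mu i \<noteq> 0) \<or>
      (\<exists>i. k = Inr (Inr (Inl i)) \<and> i \<in> {1..qq P} \<and> etaG i \<noteq> 0) \<or>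
      (\<exists>i. k = Inr (Inr (Inr i)) \<and> i \<in> {1..qq P} \<and> etaH i \<noteq> 0)" if "k \<in> T" for k
    using that inT by (metis sumE)
  have lam_T: "i \<in> I_g P xs \<and> lam i > 0" if "i \<in> {1..mm P}" "lam i \<noteq> 0" for i
    using lam that by force
  have feas: "HH P i xs \<ge> 0" "GG P i xs * HH P i xs \<le> 0" if "i \<in> {1..qq P}" for i
    using assms(2) that by (auto simp: feasible_set_def)
  have etaG_T: "i \<in> I_p0 P xs \<union> I_00 P xs \<and> etaG i > 0" if i: "i \<in> {1..qq P}" "etaG i \<noteq> 0" for i
  proof -
    have "GG P i xs \<le> 0" if "HH P i xs > 0"
      using feas(2)[OF i(1)] that by (simp add: mult_le_0_iff)
    \<comment> \<open>Feasibility excludes \<open>H > 0\<close> together with \<open>G > 0\<close>,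
      so these five sets exhaust the indices; \<open>etaG\<close> vanishes on the last
      three.\<close>
    then have "i \<in> I_p0 P xs \<union> I_00 P xs \<union> (I_pm P xs \<union> I_0m P xs \<union> I_0p P xs)"
      using feas(1)[OF i(1)] i(1)
      unfolding I_p0_def I_00_def I_pm_def I_0m_def I_0p_def by force
    then show ?thesis
      using etaG i(2) by force
  qed
  have etaH_T: "i \<in> I_0p P xs \<union> I_00 P xs \<union> I_0m P xs" if i: "i \<in> {1..qq P}" "etaH i \<noteq> 0" for i
  proof -
    have "HH P i xs = 0"
      using feas(1)[OF i(1)] etaH i unfolding I_p_def by force
    then show ?thesis
      using i unfolding I_00_def I_0m_def I_0p_def by force
  qed
  have C1: "GDERIV (F k) x :> D k x" "continuous_on UNIV (D k)" if "k \<in> N" for k x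
  proof -
    have C1_imp: "GDERIV f x :> grad f x" "continuous_on UNIV (grad f)"
      if "continuously_differentiable f" for f :: "real^'n \<Rightarrow> real"
      using that by (auto simp: continuously_differentiable_def GDERIV_grad)
    show "GDERIV (F k) x :> D k x" "continuous_on UNIV (D k)"
      using that assms(1) unfolding N_def F_def D_def mpvc_C1_def
      by (auto intro!: C1_imp GDERIV_minus continuous_on_minus)
  qed
  show False
  proof (rule no_positive_relation_of_cpld[where T = T and F = F and D = D and a = xs and X = X and c = c])
    show "T \<noteq> {}"
      using nonzero inT by blast
    show "F k xs = 0" if "k \<in> T" for k
    proof -
      have "gg P i xs = 0" if "i \<in> {1..mm P}" "lam i \<noteq> 0" for i
        using lam_T[OF that] by (simp add: I_g_def)
      moreover have "hh P i xs = 0" if "i \<in> {1..pp P}" for i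
        using assms(2) that by (simp add: feasible_set_def)
      moreover have "GG P i xs = 0" if "i \<in> {1..qq P}" "etaG i \<noteq> 0" for i
        using etaG_T[OF that] by (auto simp: I_p0_def I_00_def)
      moreover have "HH P i xs = 0" if "i \<in> {1..qq P}" "etaH i \<noteq> 0" for i
        using etaH_T[OF that] by (auto simp: I_00_def I_0m_def I_0p_def)
      ultimately show ?thesis
        using casesT[OF that] by (elim disjE exE conjE) (simp_all add: F_def)
    qed
    show "c i * F i (X k) > 0" if "i \<in> T" for i k
      using casesT[OF that] signs lam_T etaG_T
      by (elim disjE exE conjE) (simp_all add: c_def F_def)
    have "(\<Sum>i\<in>T. c i *\<^sub>R D i xs) = (\<Sum>i\<in>N. c i *\<^sub>R D i xs)"
      using \<open>finite N\<close> by (intro sum.mono_neutral_left) (auto simp: T_def)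
    also have "\<dots> = 0"
      using rel by (simp add: N_def sum.Plus c_def D_def sum_negf comp_def algebra_simps)
    finally show "(\<Sum>i\<in>T. c i *\<^sub>R D i xs) = 0" .
  next
    fix S d
    assume S: "S \<subseteq> T" "S \<noteq> {}" and d: "\<And>i. i \<in> S \<Longrightarrow> d i * c i > 0"
      and rel_S: "(\<Sum>i\<in>S. d i *\<^sub>R D i xs) = 0"
    have "finite S"
      using S \<open>finite T\<close> finite_subset by blast
    then have fin: "finite (Inr -` S)" "finite (Inr -` Inr -` S)"
      by (simp_all add: finite_vimageI)
    define J0 where "J0 = Inl -` S"
    define Ih where "Ih = Inl -` Inr -` S"
    define L0G where "L0G = Inl -` Inr -` Inr -` S"
    define L0H where "L0H = Inr -` Inr -` Inr -` S"
    note index_defs = J0_def Ih_def L0G_def L0H_def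
    have sum_S: "sum \<phi> S = (\<Sum>j\<in>J0. \<phi> (Inl j)) + ((\<Sum>i\<in>Ih. \<phi> (Inr (Inl i))) +
        ((\<Sum>l\<in>L0G. \<phi> (Inr (Inr (Inl l)))) + (\<Sum>l\<in>L0H. \<phi> (Inr (Inr (Inr l))))))"
      for \<phi> :: "_ \<Rightarrow> real^'n"
      unfolding index_defs by (simp only: sum_vimage_Inl_Inr[OF \<open>finite S\<close>]
        sum_vimage_Inl_Inr[OF fin(1)] sum_vimage_Inl_Inr[OF fin(2)])
    have sub: "Ih \<subseteq> {1..pp P}" "J0 \<subseteq> I_g P xs" "L0H \<subseteq> I_0p P xs \<union> I_00 P xs \<union> I_0m P xs"
      "L0G \<subseteq> I_p0 P xs \<union> I_00 P xs"
      using S(1) inT lam_T etaG_T etaH_T unfolding index_defs by blast+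
    have dnz: "d i \<noteq> 0" if "i \<in> S" for i
      using d[OF that] by auto
    \<comment> \<open>Extension by zero outside the chosen index sets is the convention of CPLD; it
      gives the complementarity products a meaning at every index of \<open>I_00\<close>.\<close>
    define etaG' where "etaG' l = (if l \<in> L0G then d (Inr (Inr (Inl l))) else 0)" for l
    define etaH' where "etaH' l = (if l \<in> L0H then d (Inr (Inr (Inr l))) else 0)" for l
    have "d (Inl j) \<ge> 0" if "j \<in> J0" for j
    proof -
      \<comment> \<open>Agreement in sign with \<open>lam\<close> is what keeps the inequality
        multipliers nonnegative after the reduction.\<close>
      have "d (Inl j) * lam j > 0" "lam j > 0"
        using d[of "Inl j"] that S(1) inT(1)[of j] lam_T[of j] by (auto simp: J0_def c_def)
      then show ?thesis
        by (simp add: zero_less_mult_iff)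
    qed
    moreover have "(\<exists>j\<in>J0. d (Inl j) \<noteq> 0) \<or> (\<exists>i\<in>Ih. d (Inr (Inl i)) \<noteq> 0) \<or>
        (\<exists>l\<in>L0H. etaH' l \<noteq> 0) \<or> (\<exists>l\<in>L0G. etaG' l \<noteq> 0)"
    proof -
      obtain k where "k \<in> S" "k \<in> T"
        using S by blast
      then have "(\<exists>j. j \<in> J0) \<or> (\<exists>i. i \<in> Ih) \<or> (\<exists>l. l \<in> L0G) \<or> (\<exists>l. l \<in> L0H)"
        using casesT[OF \<open>k \<in> T\<close>] by (elim disjE exE conjE) (auto simp: index_defs)
      then show ?thesis
        using dnz unfolding etaG'_def etaH'_def by (auto simp: index_defs)
    qed
    moreover have "(\<Sum>j\<in>J0. d (Inl j) *\<^sub>R grad (gg P j) xs)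
        + (\<Sum>i\<in>Ih. d (Inr (Inl i)) *\<^sub>R grad (hh P i) xs)
        + (\<Sum>l\<in>L0G. etaG' l *\<^sub>R grad (GG P l) xs) - (\<Sum>l\<in>L0H. etaH' l *\<^sub>R grad (HH P l) xs) = 0"
      using rel_S by (simp add: sum_S D_def etaG'_def etaH'_def sum_negf algebra_simps)
    moreover have "\<forall>l\<in>I_00 P xs. etaG' l * etaH' l = 0"
    proof
      fix l assume "l \<in> I_00 P xs"
      then have "etaG l = 0 \<or> etaH l = 0"
        using compl by auto
      then have "l \<notin> L0G \<or> l \<notin> L0H"
        using S(1) inT(3,4)[of l] by (auto simp: index_defs)
      then show "etaG' l * etaH' l = 0"
        by (auto simp: etaG'_def etaH'_def)
    qed
    moreover have "\<forall>l. l \<notin> L0G \<longrightarrow> etaG' l = 0" "\<forall>l. l \<notin> L0H \<longrightarrow> etaH' l = 0"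
      by (simp_all add: etaG'_def etaH'_def)
    ultimately have "\<exists>lam mu etaH etaG :: nat \<Rightarrow> real.
           (\<forall>j\<in>J0. lam j \<ge> 0) \<and>
           (\<forall>l. l \<notin> L0G \<longrightarrow> etaG l = 0) \<and>
           (\<forall>l. l \<notin> L0H \<longrightarrow> etaH l = 0) \<and>
           ((\<exists>j\<in>J0. lam j \<noteq> 0) \<or> (\<exists>i\<in>Ih. mu i \<noteq> 0) \<or>
            (\<exists>l\<in>L0H. etaH l \<noteq> 0) \<or> (\<exists>l\<in>L0G. etaG l \<noteq> 0)) \<and>
           (\<Sum>j\<in>J0. lam j *\<^sub>R grad (gg P j) xs) + (\<Sum>i\<in>Ih. mu i *\<^sub>R grad (hh P i) xs)
             + (\<Sum>l\<in>L0G. etaG l *\<^sub>R grad (GG P l) xs)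
             - (\<Sum>l\<in>L0H. etaH l *\<^sub>R grad (HH P l) xs) = 0 \<and>
           (\<forall>l\<in>I_00 P xs. etaG l * etaH l = 0)"
      by (intro exI[of _ "\<lambda>j. d (Inl j)"] exI[of _ "\<lambda>i. d (Inr (Inl i))"]
          exI[of _ etaH'] exI[of _ etaG']) simp
    with assms(3)[unfolded MPVC_CPLD_def, rule_format, OF sub]
    obtain W where W: "open W" "xs \<in> W" "\<forall>x\<in>W. gradients_dependent P Ih J0 L0H L0G x"
      by blast
    have "\<exists>b. (\<exists>i\<in>S. b i \<noteq> 0) \<and> (\<Sum>i\<in>S. b i *\<^sub>R D i x) = 0" if "x \<in> W" for x
    proof -
      from W(3) that have "gradients_dependent P Ih J0 L0H L0G x"
        by blast
      then obtain a b c d :: "nat \<Rightarrow> real" where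
        nz: "(\<exists>i\<in>Ih. a i \<noteq> 0) \<or> (\<exists>j\<in>J0. b j \<noteq> 0) \<or> (\<exists>l\<in>L0G. c l \<noteq> 0) \<or> (\<exists>l\<in>L0H. d l \<noteq> 0)"
        and sum_0: "(\<Sum>i\<in>Ih. a i *\<^sub>R grad (hh P i) x) + (\<Sum>j\<in>J0. b j *\<^sub>R grad (gg P j) x)
          + (\<Sum>l\<in>L0G. c l *\<^sub>R grad (GG P l) x) + (\<Sum>l\<in>L0H. d l *\<^sub>R grad (HH P l) x) = 0"
        unfolding gradients_dependent_def by (elim exE conjE)
      \<comment> \<open>Here \<open>c\<close> and \<open>d\<close> are coefficients of the
        dependence at \<open>x\<close>. The sign of \<open>d\<close> is reversed because
        \<open>D\<close> carries the negated gradients of \<open>H\<close>.\<close>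
      define r where "r = case_sum b (case_sum a (case_sum c (\<lambda>l. - d l)))"
      have "\<exists>i\<in>S. r i \<noteq> 0"
        using nz unfolding index_defs r_def by (force intro: bexI)
      moreover have "(\<Sum>i\<in>S. r i *\<^sub>R D i x) = 0"
        using sum_0 by (simp add: sum_S D_def r_def algebra_simps)
      ultimately show ?thesis by blast
    qed
    then show "\<exists>W. open W \<and> xs \<in> W \<and>
        (\<forall>x\<in>W. \<exists>b. (\<exists>i\<in>S. b i \<noteq> 0) \<and> (\<Sum>i\<in>S. b i *\<^sub>R D i x) = 0)"
      using W by blast
  qed (use \<open>finite T\<close> X C1 T_def in auto)
qed

end
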